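(* For $K\in\mathbb R^{m\times p}$, $h\in\mathbb R^p$, $\alpha\in(0,1)$ and $y\in\mathbb R^m$ define the Rust–Burrus interval $$I_{\mathrm{RB}}(y)=\Big[\min_{x\ge0,\ \|y-Kx\|_2^2\le\psi_\alpha^2(y)}h^\top x,\ \max_{x\ge0,\ \|y-Kx\|_2^2\le\psi_\alpha^2(y)}h^\top x\Big],\qquad \psi^2_\alpha(y)=z_{\alpha/2}^2+s^2(y),\quad s^2(y)=\min_{x\ge0}\|y-Kx\|_2^2,$$ where $z_{\alpha/2}$ satisfies $\mathbb P(N>z_{\alpha/2})=\alpha/2$ for $N\sim\mathcal N(0,1)$. Consider the model $y\sim\mathcal N(Kx^*,I_m)$ with $x^*\ge0$. (a) For $K=I_2$, $h=(1,-1)^\top$ and $x^*=(a,a)^\top$ with any $a\ge0$, one has $\mathbb P(h^\top x^*\in I_{\mathrm{RB}}(y))\ge1-\alpha$ for every $\alpha\in(0,1)$; so this is not a counterexample to the conjecture that $I_{\mathrm{RB}}$ always has coverage at least $1-\alpha$. (b) For $K=I_3$, $h=(1,1,-1)^\top$ and $x^*=(0,0,1)^\top$, there exists $\alpha\in(0,1)$ with $\mathbb P(h^\top x^*\in I_{\mathrm{RB}}(y))<1-\alpha$. Hence the Rust–Burrus conjecture (that $I_{\mathrm{RB}}(y)$ is a valid $1-\alpha$ confidence interval for $h^\top x^*$ for all $K,h,x^*\ge0,\alpha$) is false.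
   Context: Inequalities $x\ge0$ between vectors are componentwise. *)

theory Defs
  imports "HOL-Probability.Probability"
begin

definition nonneg_vec :: "real ^ 'n \<Rightarrow> bool" where
  "nonneg_vec x \<longleftrightarrow> (\<forall>i. 0 \<le> x $ i)"

definition gauss_vec :: "real ^ 'n \<Rightarrow> (real ^ 'n) measure" where
  "gauss_vec mu = density lborel (\<lambda>y. ennreal (\<Prod>i\<in>UNIV. std_normal_density (y $ i - mu $ i)))"

definition z_quant :: "real \<Rightarrow> real" where
  "z_quant \<alpha> = (THE z. measure (density lborel std_normal_density) {z<..} = \<alpha> / 2)"

definition s_sq :: "real ^ 'p ^ 'm \<Rightarrow> real ^ 'm \<Rightarrow> real" where
  "s_sq K y = Inf {(norm (y - K *v x))\<^sup>2 | x. nonneg_vec x}"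

definition psi_sq :: "real ^ 'p ^ 'm \<Rightarrow> real \<Rightarrow> real ^ 'm \<Rightarrow> real" where
  "psi_sq K \<alpha> y = (z_quant \<alpha>)\<^sup>2 + s_sq K y"

definition rb_feasible :: "real ^ 'p ^ 'm \<Rightarrow> real \<Rightarrow> real ^ 'm \<Rightarrow> (real ^ 'p) set" where
  "rb_feasible K \<alpha> y = {x. nonneg_vec x \<and> (norm (y - K *v x))\<^sup>2 \<le> psi_sq K \<alpha> y}"

text \<open>The Rust--Burrus interval [min h.x, max h.x] over the feasible set (endpoints taken
  in the extended reals, so that the definition makes sense also for unbounded problems).\<close>
definition I_RB :: "real ^ 'p ^ 'm \<Rightarrow> real ^ 'p \<Rightarrow> real \<Rightarrow> real ^ 'm \<Rightarrow> real set" where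
  "I_RB K h \<alpha> y = {t. (INF x\<in>rb_feasible K \<alpha> y. ereal (h \<bullet> x)) \<le> ereal t
                     \<and> ereal t \<le> (SUP x\<in>rb_feasible K \<alpha> y. ereal (h \<bullet> x))}"

definition coverage :: "real ^ 'p ^ 'm \<Rightarrow> real ^ 'p \<Rightarrow> real ^ 'p \<Rightarrow> real \<Rightarrow> real" where
  "coverage K h xstar \<alpha> = measure (gauss_vec (K *v xstar)) {y. h \<bullet> xstar \<in> I_RB K h \<alpha> y}"

end

theory Submission
  imports Defs
begin

text \<open>
  For \<open>K = I\<close> the target value lies in the interval iff the distance of \<open>y\<close> to the slice
  \<open>{x \<ge> 0. h\<^sup>T x = h\<^sup>T x\<^sup>*}\<close> satisfies \<open>dist\<^sup>2 \<le> z\<^sup>2 + s\<^sup>2(y)\<close>. In (a) this holds whenever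
  \<open>|y\<^sub>1 - y\<^sub>2| \<le> \<surd>2 z\<close>, an event of probability exactly \<open>1 - \<alpha>\<close>.

  For (b) take \<open>\<alpha>\<close> close to 1, that is \<open>z\<close> small, and write \<open>y = x\<^sup>* + (u, v, w)\<close>. Up to an event
  of probability \<open>O(z\<^sup>2)\<close>, coverage forces \<open>(u, v, w)\<close> to be within distance \<open>z\<close> of the polyhedral
  surface \<open>w = u\<^sup>+ + v\<^sup>+\<close>, whose four faces are plane sectors of angles 90, 90, 90 and 60 degrees.
  A \<open>z\<close>-neighbourhood of a whole plane through 0 has probability \<open>1 - \<alpha>\<close>, so the coverage is about
  \<open>330/360 (1 - \<alpha>)\<close>. Instead of the exact angle of the last face it is enough to use
  \<open>(u + v)\<^sup>2 \<ge> u\<^sup>2 + v\<^sup>2\<close> there, which gives \<open>\<surd>3/8 < 1/4\<close> in place of \<open>60/360\<close>.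
\<close>

subsection \<open>Standard normal vectors and the quantile\<close>

abbreviation std_normal :: "real measure" where
  "std_normal \<equiv> density lborel std_normal_density"

section \<open>Lebesgue and Gaussian measures on \<open>real^2\<close> and \<open>real^3\<close> as
  images of product measures\<close>

lemma prod_Basis_vec:
  "(\<Prod>b\<in>(Basis :: (real ^ 'n) set). g b) = (\<Prod>i\<in>UNIV. g (axis i 1))"
proof -
  have "(Basis :: (real ^ 'n) set) = (\<lambda>i. axis i 1) ` UNIV"
    by (auto simp: Basis_vec_def)
  moreover have "inj (\<lambda>i::'n. axis i (1::real))"
    by (auto simp: inj_def axis_eq_axis)
  ultimately show ?thesis
    by (metis (no_types, lifting) prod.reindex_cong)
qed

lemma prod_UNIV_2: "prod f (UNIV :: 2 set) = f 1 * f 2"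
  unfolding UNIV_2 by simp

lemma prod_UNIV_3: "prod f (UNIV :: 3 set) = f 1 * (f 2 * f 3)"
  unfolding UNIV_3 by simp

lemma measurable_vector_2 [measurable]:
  assumes "f \<in> borel_measurable M" "g \<in> borel_measurable M"
  shows "(\<lambda>x. vector [f x, g x] :: real^2) \<in> borel_measurable M"
proof -
  have "(\<lambda>x. vector [f x, g x] :: real^2) = (\<lambda>x. f x *\<^sub>R axis 1 1 + g x *\<^sub>R axis 2 1)"
    by (auto simp: vec_eq_iff forall_2 axis_def)
  with assms show ?thesis by simp
qed

lemma measurable_vector_3 [measurable]:
  assumes "f \<in> borel_measurable M" "g \<in> borel_measurable M" "h \<in> borel_measurable M"
  shows "(\<lambda>x. vector [f x, g x, h x] :: real^3) \<in> borel_measurable M"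
proof -
  have "(\<lambda>x. vector [f x, g x, h x] :: real^3) =
      (\<lambda>x. f x *\<^sub>R axis 1 1 + g x *\<^sub>R axis 2 1 + h x *\<^sub>R axis 3 1)"
    by (auto simp: vec_eq_iff forall_3 axis_def)
  with assms show ?thesis by simp
qed

text \<open>Both measures agree on boxes. The shift by \<open>mu\<close> is built in so that the
  density of \<open>gauss_vec mu\<close>, pulled back along the map, becomes a product of centred
  normal densities.\<close>

lemma lborel_vec_2:
  fixes mu :: "real^2"
  shows "(lborel :: (real^2) measure) =
    distr (lborel \<Otimes>\<^sub>M lborel) borel (\<lambda>(a, b). vector [a + mu$1, b + mu$2])"
    (is "_ = distr _ _ ?f")
proof (rule lborel_eqI)
  fix l u :: "real^2"
  assume le: "\<And>b. b \<in> Basis \<Longrightarrow> l \<bullet> b \<le> u \<bullet> b"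
  have le': "0 \<le> u$i - l$i" for i
    using le[of "axis i 1"] by (simp add: inner_axis)
  have meas: "?f \<in> lborel \<Otimes>\<^sub>M lborel \<rightarrow>\<^sub>M borel"
    unfolding case_prod_unfold by (intro measurable_vector_2) measurable
  have "?f -` box l u \<inter> space (lborel \<Otimes>\<^sub>M lborel) =
      {l$1 - mu$1 <..< u$1 - mu$1} \<times> {l$2 - mu$2 <..< u$2 - mu$2}"
    by (auto simp: mem_box_cart forall_2 space_pair_measure)
  then have "emeasure (distr (lborel \<Otimes>\<^sub>M lborel) borel ?f) (box l u) =
      emeasure lborel {l$1 - mu$1 <..< u$1 - mu$1} * emeasure lborel {l$2 - mu$2 <..< u$2 - mu$2}"
    by (subst emeasure_distr[OF meas]) (simp_all add: lborel.emeasure_pair_measure_Times)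
  also have "\<dots> = ennreal (u$1 - l$1) * ennreal (u$2 - l$2)"
    using le'[of 1] le'[of 2] by simp
  also have "\<dots> = ennreal ((u$1 - l$1) * (u$2 - l$2))"
    using le' by (simp add: ennreal_mult)
  also have "(u$1 - l$1) * (u$2 - l$2) = (\<Prod>b\<in>Basis. (u - l) \<bullet> b)"
    by (simp add: prod_Basis_vec prod_UNIV_2 inner_axis)
  finally show "emeasure (distr (lborel \<Otimes>\<^sub>M lborel) borel ?f) (box l u) =
      (\<Prod>b\<in>Basis. (u - l) \<bullet> b)" .
qed simp

lemma lborel_vec_3:
  fixes mu :: "real^3"
  shows "(lborel :: (real^3) measure) = distr (lborel \<Otimes>\<^sub>M (lborel \<Otimes>\<^sub>M lborel)) borel
    (\<lambda>(a, b, c). vector [a + mu$1, b + mu$2, c + mu$3])"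
    (is "_ = distr _ _ ?f")
proof (rule lborel_eqI)
  fix l u :: "real^3"
  assume le: "\<And>b. b \<in> Basis \<Longrightarrow> l \<bullet> b \<le> u \<bullet> b"
  have le': "0 \<le> u$i - l$i" for i
    using le[of "axis i 1"] by (simp add: inner_axis)
  have meas: "?f \<in> lborel \<Otimes>\<^sub>M (lborel \<Otimes>\<^sub>M lborel) \<rightarrow>\<^sub>M borel"
    unfolding case_prod_unfold by (intro measurable_vector_3) measurable
  have "?f -` box l u \<inter> space (lborel \<Otimes>\<^sub>M (lborel \<Otimes>\<^sub>M lborel)) =
      {l$1 - mu$1 <..< u$1 - mu$1} \<times> {l$2 - mu$2 <..< u$2 - mu$2} \<times> {l$3 - mu$3 <..< u$3 - mu$3}"
    by (auto simp: mem_box_cart forall_3 space_pair_measure)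
  then have "emeasure (distr (lborel \<Otimes>\<^sub>M (lborel \<Otimes>\<^sub>M lborel)) borel ?f) (box l u) =
      emeasure lborel {l$1 - mu$1 <..< u$1 - mu$1} * (emeasure lborel {l$2 - mu$2 <..< u$2 - mu$2} *
      emeasure lborel {l$3 - mu$3 <..< u$3 - mu$3})"
    by (subst emeasure_distr[OF meas])
       (simp_all add: lborel.emeasure_pair_measure_Times
        sigma_finite_measure.emeasure_pair_measure_Times[OF lborel_pair.sigma_finite_measure_axioms])
  also have "\<dots> = ennreal (u$1 - l$1) * (ennreal (u$2 - l$2) * ennreal (u$3 - l$3))"
    using le'[of 1] le'[of 2] le'[of 3] by simp
  also have "\<dots> = ennreal ((u$1 - l$1) * ((u$2 - l$2) * (u$3 - l$3)))"
    using le' by (simp add: ennreal_mult)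
  also have "(u$1 - l$1) * ((u$2 - l$2) * (u$3 - l$3)) = (\<Prod>b\<in>Basis. (u - l) \<bullet> b)"
    by (simp add: prod_Basis_vec prod_UNIV_3 inner_axis)
  finally show "emeasure (distr (lborel \<Otimes>\<^sub>M (lborel \<Otimes>\<^sub>M lborel)) borel ?f) (box l u) =
      (\<Prod>b\<in>Basis. (u - l) \<bullet> b)" .
qed simp

lemma prob_space_std_normal: "prob_space std_normal"
  using prob_space_normal_density[of 1 0] by simp

interpretation N: prob_space std_normal
  by (rule prob_space_std_normal)

interpretation NN: pair_prob_space std_normal std_normal ..

interpretation NNN: pair_prob_space std_normal "std_normal \<Otimes>\<^sub>M std_normal" ..

lemma std_normal_pair:
  "std_normal \<Otimes>\<^sub>M std_normal = density (lborel \<Otimes>\<^sub>M lborel)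
    (\<lambda>(a, b). ennreal (std_normal_density a) * ennreal (std_normal_density b))"
  by (rule pair_measure_density)
     (auto intro: lborel.sigma_finite_measure_axioms N.sigma_finite_measure_axioms)

lemma std_normal_triple:
  "std_normal \<Otimes>\<^sub>M (std_normal \<Otimes>\<^sub>M std_normal) = density (lborel \<Otimes>\<^sub>M (lborel \<Otimes>\<^sub>M lborel))
    (\<lambda>(a, b, c). ennreal (std_normal_density a) *
      (ennreal (std_normal_density b) * ennreal (std_normal_density c)))"
proof -
  let ?g = "\<lambda>(a, b). ennreal (std_normal_density a) * ennreal (std_normal_density b)"
  have "sigma_finite_measure (density (lborel \<Otimes>\<^sub>M lborel) ?g)"
    using NN.sigma_finite_measure_axioms by (simp add: std_normal_pair)
  then have "std_normal \<Otimes>\<^sub>M density (lborel \<Otimes>\<^sub>M lborel) ?g =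
      density (lborel \<Otimes>\<^sub>M (lborel \<Otimes>\<^sub>M lborel)) (\<lambda>(a, p). ennreal (std_normal_density a) * ?g p)"
    by (intro pair_measure_density lborel_pair.sigma_finite_measure_axioms) measurable
  then show ?thesis
    unfolding std_normal_pair by (simp add: case_prod_unfold)
qed

text \<open>This turns coverage into a statement about independent standard normal coordinates,
  where Fubini, reflection and convolution apply.\<close>

lemma gauss_vec_2:
  fixes mu :: "real^2"
  shows "gauss_vec mu = distr (std_normal \<Otimes>\<^sub>M std_normal) borel
    (\<lambda>(a, b). vector [a + mu$1, b + mu$2])"
proof -
  have "(\<lambda>(a, b). vector [a + mu$1, b + mu$2] :: real^2) \<in> lborel \<Otimes>\<^sub>M lborel \<rightarrow>\<^sub>M borel"
    unfolding case_prod_unfold by (intro measurable_vector_2) measurable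
  then show ?thesis
    unfolding gauss_vec_def std_normal_pair
    by (subst lborel_vec_2[of mu], subst density_distr)
       (simp_all add: prod_UNIV_2 case_prod_unfold ennreal_mult)
qed

lemma gauss_vec_3:
  fixes mu :: "real^3"
  shows "gauss_vec mu = distr (std_normal \<Otimes>\<^sub>M (std_normal \<Otimes>\<^sub>M std_normal)) borel
    (\<lambda>(a, b, c). vector [a + mu$1, b + mu$2, c + mu$3])"
proof -
  have "(\<lambda>(a, b, c). vector [a + mu$1, b + mu$2, c + mu$3] :: real^3)
      \<in> lborel \<Otimes>\<^sub>M (lborel \<Otimes>\<^sub>M lborel) \<rightarrow>\<^sub>M borel"
    unfolding case_prod_unfold by (intro measurable_vector_3) measurable
  then show ?thesis
    unfolding gauss_vec_def std_normal_triple
    by (subst lborel_vec_3[of mu], subst density_distr)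
       (simp_all add: prod_UNIV_3 case_prod_unfold ennreal_mult)
qed

section \<open>Symmetry, interval bounds and tails of the standard normal law on the line\<close>

lemma emeasure_std_normal_uminus:
  assumes "A \<in> sets borel"
  shows "emeasure std_normal {x. - x \<in> A} = emeasure std_normal A"
proof -
  have [measurable]: "A \<in> sets borel" by fact
  have "(uminus :: real \<Rightarrow> real) \<in> borel_measurable borel" by simp
  from measurable_sets[OF this assms] have [measurable]: "{x. - x \<in> A} \<in> sets borel"
    by (simp add: vimage_def)
  have "emeasure std_normal {x. - x \<in> A} =
      (\<integral>\<^sup>+x. ennreal (std_normal_density (- x)) * indicator A (- x) \<partial>lborel)"
    by (subst emeasure_density) (auto simp: std_normal_density_def indicator_def intro!: nn_integral_cong)
  also have "\<dots> = (\<integral>\<^sup>+x. ennreal (std_normal_density x) * indicator A x \<partial>distr lborel borel uminus)"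
    by (subst nn_integral_distr) auto
  also have "\<dots> = emeasure std_normal A"
    by (simp add: lborel_distr_uminus emeasure_density)
  finally show ?thesis .
qed

lemma emeasure_std_normal_interval_le:
  assumes "a \<le> b" "\<And>x. x \<in> {a..b} \<Longrightarrow> std_normal_density x \<le> c"
  shows "emeasure std_normal {a..b} \<le> ennreal (c * (b - a))"
proof -
  have "0 \<le> c" using assms normal_density_nonneg
    by (meson atLeastAtMost_iff order_refl order_trans)
  have "emeasure std_normal {a..b} = (\<integral>\<^sup>+x. ennreal (std_normal_density x) * indicator {a..b} x \<partial>lborel)"
    by (simp add: emeasure_density)
  also have "\<dots> \<le> (\<integral>\<^sup>+x. ennreal c * indicator {a..b} x \<partial>lborel)"
    using assms(2) by (intro nn_integral_mono) (auto simp: indicator_def ennreal_leI)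
  also have "\<dots> = ennreal (c * (b - a))"
    using assms(1) \<open>0 \<le> c\<close> by (simp add: nn_integral_cmult ennreal_mult')
  finally show ?thesis .
qed

lemma emeasure_std_normal_interval_ge:
  assumes "a \<le> b" "0 \<le> c" "\<And>x. x \<in> {a..b} \<Longrightarrow> c \<le> std_normal_density x"
  shows "ennreal (c * (b - a)) \<le> emeasure std_normal {a..b}"
proof -
  have "ennreal (c * (b - a)) = (\<integral>\<^sup>+x. ennreal c * indicator {a..b} x \<partial>lborel)"
    using assms(1,2) by (simp add: nn_integral_cmult ennreal_mult')
  also have "\<dots> \<le> (\<integral>\<^sup>+x. ennreal (std_normal_density x) * indicator {a..b} x \<partial>lborel)"
    using assms(3) by (intro nn_integral_mono) (auto simp: indicator_def ennreal_leI)
  also have "\<dots> = emeasure std_normal {a..b}"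
    by (simp add: emeasure_density)
  finally show ?thesis .
qed

lemma std_normal_singleton: "measure std_normal {x} = 0"
  using emeasure_std_normal_interval_le[of x x "std_normal_density x"]
  by (simp add: measure_def)

lemma std_normal_density_antimono_abs:
  assumes "\<bar>x\<bar> \<le> \<bar>y\<bar>"
  shows "std_normal_density y \<le> std_normal_density x"
proof -
  have "x\<^sup>2 \<le> y\<^sup>2" using assms by (simp add: abs_le_square_iff)
  then show ?thesis by (simp add: std_normal_density_def divide_right_mono)
qed

lemma std_normal_interval_pos:
  assumes "a < b"
  shows "0 < measure std_normal {a..b}"
proof -
  define c where "c = std_normal_density (max \<bar>a\<bar> \<bar>b\<bar>)"
  have "0 < c" unfolding c_def by (intro normal_density_pos) simp
  have "ennreal (c * (b - a)) \<le> emeasure std_normal {a..b}"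
    using assms \<open>0 < c\<close> by (intro emeasure_std_normal_interval_ge)
      (auto simp: c_def intro!: std_normal_density_antimono_abs)
  then have "c * (b - a) \<le> measure std_normal {a..b}"
    by (simp add: N.emeasure_eq_measure)
  with assms \<open>0 < c\<close> show ?thesis by (smt (verit) mult_pos_pos)
qed

text \<open>The interval from the midpoint to \<open>b\<close> has positive mass and separates the
  two tails. Strictness is what makes the description in \<open>z_quant\<close> unique.\<close>

lemma std_normal_tail_strict_antimono:
  assumes "a < b"
  shows "measure std_normal {b<..} < measure std_normal {a<..}"
proof -
  have "measure std_normal {b<..} + measure std_normal {(a+b)/2..b} =
      measure std_normal ({b<..} \<union> {(a+b)/2..b})"
    by (rule N.finite_measure_Union[symmetric]) auto
  also have "\<dots> \<le> measure std_normal {a<..}"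
    using assms by (intro N.finite_measure_mono) auto
  finally show ?thesis
    using std_normal_interval_pos[of "(a+b)/2" b] assms by (simp add: field_simps)
qed

lemma std_normal_tail_symmetric:
  "measure std_normal {..<-z} = measure std_normal {z<..}"
proof -
  have "{x. - x \<in> {z<..}} = {..<-z}" by auto
  with emeasure_std_normal_uminus[of "{z<..}"] show ?thesis
    by (simp add: measure_def)
qed

lemma std_normal_central:
  assumes "0 \<le> z"
  shows "measure std_normal {-z..z} = 1 - 2 * measure std_normal {z<..}"
proof -
  have "{-z..z} = UNIV - ({..<-z} \<union> {z<..})" by auto
  moreover have "measure std_normal ({..<-z} \<union> {z<..}) =
      measure std_normal {..<-z} + measure std_normal {z<..}"
    using assms by (intro N.finite_measure_Union) auto
  ultimately show ?thesis
    using N.prob_compl[of "{..<-z} \<union> {z<..}"] by (simp add: std_normal_tail_symmetric)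
qed

lemma std_normal_half: "measure std_normal {0<..} = 1/2" "measure std_normal {..0} = 1/2"
proof -
  show *: "measure std_normal {0<..} = 1/2"
    using std_normal_central[of 0] by (simp add: std_normal_singleton)
  have "{..0} = UNIV - {0::real<..}" by auto
  then show "measure std_normal {..0} = 1/2"
    using N.prob_compl[of "{0<..}"] * by simp
qed

section \<open>The quantile, and the difference of two independent normals\<close>

lemma z_quant_eqI:
  assumes "measure std_normal {z<..} = \<alpha> / 2"
  shows "z_quant \<alpha> = z"
  unfolding z_quant_def
proof (rule the_equality)
  fix y assume "measure std_normal {y<..} = \<alpha> / 2"
  with assms show "y = z"
    using std_normal_tail_strict_antimono by (metis less_irrefl linorder_neqE)
qed (fact assms)

text \<open>Without atoms the distribution function is continuous, so it takes the value
  \<open>1 - \<alpha>/2\<close> between 0, where it equals 1/2, and a far point. Since \<alpha> < 1,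
  that value is not taken at 0.\<close>

lemma z_quant_props:
  assumes "0 < \<alpha>" "\<alpha> < 1"
  shows "0 < z_quant \<alpha>" "measure std_normal {- z_quant \<alpha>..z_quant \<alpha>} = 1 - \<alpha>"
proof -
  interpret R: real_distribution std_normal by standard simp
  have cdf: "measure std_normal {z<..} = 1 - cdf std_normal z" for z
  proof -
    have "{z<..} = UNIV - {..z}" by auto
    then show ?thesis using N.prob_compl[of "{..z}"] by (simp add: cdf_def)
  qed
  have "\<forall>\<^sub>F x in at_top. 1 - \<alpha>/2 < cdf std_normal x"
    using R.cdf_lim_at_top_prob assms by (intro order_tendstoD(1)) auto
  then obtain b where b: "1 - \<alpha>/2 < cdf std_normal b"
    by (metis eventually_at_top_linorder order_refl)
  have c0: "cdf std_normal 0 = 1/2" by (simp add: cdf_def std_normal_half)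
  have "0 \<le> b"
    using R.cdf_nondecreasing[of b 0] b c0 assms by (cases "0 \<le> b") auto
  have "\<exists>x\<ge>0. x \<le> b \<and> cdf std_normal x = 1 - \<alpha>/2"
    using b c0 assms \<open>0 \<le> b\<close> by (intro IVT) (auto simp: R.isCont_cdf std_normal_singleton)
  then obtain z where z: "0 \<le> z" "cdf std_normal z = 1 - \<alpha>/2" by blast
  then have "z \<noteq> 0" using c0 assms by auto
  have t: "measure std_normal {z<..} = \<alpha>/2" using cdf z by simp
  with z_quant_eqI have "z_quant \<alpha> = z" by blast
  with z \<open>z \<noteq> 0\<close> t show "0 < z_quant \<alpha>" "measure std_normal {- z_quant \<alpha>..z_quant \<alpha>} = 1 - \<alpha>"
    by (auto simp: std_normal_central)
qed

text \<open>The difference of two independent standard normals has variance 2; rescaling by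
  \<open>sqrt 2\<close> returns to one standard normal. Geometrically, the distance to the diagonal
  is at most \<open>z\<close>.\<close>

lemma std_normal_pair_diff:
  assumes "0 \<le> z"
  shows "measure (std_normal \<Otimes>\<^sub>M std_normal) {(a, b). \<bar>a - b\<bar> \<le> sqrt 2 * z} = measure std_normal {-z..z}"
proof -
  let ?r = "sqrt 2 * z"
  have meas: "{(a::real, b). \<bar>a - b\<bar> \<le> ?r} \<in> sets (std_normal \<Otimes>\<^sub>M std_normal)"
  proof -
    have "{p \<in> space (std_normal \<Otimes>\<^sub>M std_normal). \<bar>fst p - snd p\<bar> \<le> ?r} \<in> sets (std_normal \<Otimes>\<^sub>M std_normal)"
      by measurable
    then show ?thesis by (simp add: space_pair_measure case_prod_unfold)
  qed
  have "emeasure (std_normal \<Otimes>\<^sub>M std_normal) {(a, b). \<bar>a - b\<bar> \<le> ?r} =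
      (\<integral>\<^sup>+a. emeasure std_normal {b. \<bar>a - b\<bar> \<le> ?r} \<partial>std_normal)"
    by (subst N.emeasure_pair_measure_alt[OF meas]) (simp add: vimage_def)
  \<comment> \<open>Reflecting \<open>b\<close> turns the difference into a sum, so that the
    convolution formula applies.\<close>
  also have "\<dots> = (\<integral>\<^sup>+a. emeasure std_normal {b. b + a \<in> {- ?r..?r}} \<partial>std_normal)"
  proof (rule nn_integral_cong)
    fix a :: real
    have "{b. - b \<in> {a - ?r..a + ?r}} = {b. b + a \<in> {- ?r..?r}}"
      "{b. \<bar>a - b\<bar> \<le> ?r} = {a - ?r..a + ?r}" by auto
    with emeasure_std_normal_uminus[of "{a - ?r..a + ?r}"]
    show "emeasure std_normal {b. \<bar>a - b\<bar> \<le> ?r} = emeasure std_normal {b. b + a \<in> {- ?r..?r}}"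
      by simp
  qed
  also have "\<dots> = emeasure (std_normal \<star> std_normal) {- ?r..?r}"
    by (subst convolution_emeasure) (auto intro: N.finite_measure_axioms)
  also have "std_normal \<star> std_normal = density lborel (normal_density 0 (sqrt 2))"
    by (subst convolution_density)
       (auto intro: N.finite_measure_axioms simp: fun_cong[OF conv_std_normal_density, symmetric] ennreal_mult'')
  also have "emeasure \<dots> {- ?r..?r} =
      (\<integral>\<^sup>+x. ennreal (normal_density 0 (sqrt 2) x) * indicator {- ?r..?r} x \<partial>lborel)"
    by (simp add: emeasure_density)
  also have "\<dots> = ennreal (sqrt 2) * (\<integral>\<^sup>+x. ennreal (normal_density 0 (sqrt 2) (sqrt 2 * x)) * indicator {- ?r..?r} (sqrt 2 * x) \<partial>lborel)"
    by (subst nn_integral_real_affine[of _ "sqrt 2" 0]) auto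
  also have "\<dots> = (\<integral>\<^sup>+x. ennreal (std_normal_density x) * indicator {- z..z} x \<partial>lborel)"
  proof (subst nn_integral_cmult[symmetric], simp, rule nn_integral_cong)
    fix x :: real
    have "indicator {- ?r..?r} (sqrt 2 * x) = (indicator {-z..z} x :: ennreal)"
    proof -
      have "- ?r \<le> sqrt 2 * x \<longleftrightarrow> -z \<le> x"
        using mult_le_cancel_left_pos[of "sqrt 2" "-z" x] by simp
      then show ?thesis by (simp add: indicator_def)
    qed
    moreover have "sqrt 2 * normal_density 0 (sqrt 2) (sqrt 2 * x) = std_normal_density x"
      by (simp add: normal_density_def power_mult_distrib real_sqrt_mult field_simps)
    ultimately show "ennreal (sqrt 2) * (ennreal (normal_density 0 (sqrt 2) (sqrt 2 * x)) * indicator {- ?r..?r} (sqrt 2 * x)) =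
        ennreal (std_normal_density x) * indicator {- z..z} x"
      by (metis ennreal_mult' mult.assoc real_sqrt_ge_zero zero_le_numeral)
  qed
  also have "\<dots> = emeasure std_normal {-z..z}"
    by (simp add: emeasure_density)
  finally show ?thesis by (simp add: measure_def)
qed

subsection \<open>The interval for the identity matrix\<close>

lemma norm_sq_vec: "(norm (x :: real ^ 'n))\<^sup>2 = (\<Sum>i\<in>UNIV. (x $ i)\<^sup>2)"
  unfolding power2_norm_eq_inner inner_vec_def by (simp add: power2_eq_square)

lemma closed_nonneg_vec: "closed (Collect nonneg_vec :: (real ^ 'n) set)"
proof -
  have "(Collect nonneg_vec :: (real ^ 'n) set) = (\<Inter>i. {x. 0 \<le> x $ i})"
    by (auto simp: nonneg_vec_def)
  then show ?thesis
    by (auto intro!: closed_INT closed_Collect_le continuous_intros)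
qed

lemma convex_nonneg_vec: "convex (Collect nonneg_vec :: (real ^ 'n) set)"
  by (auto simp: convex_def nonneg_vec_def)

text \<open>For the identity the minimisation decouples into coordinates, and the minimiser is the
  positive part of \<open>y\<close>.\<close>

lemma s_sq_mat_1: "s_sq (mat 1) (y :: real ^ 'n) = (\<Sum>i\<in>UNIV. (min 0 (y $ i))\<^sup>2)"
  unfolding s_sq_def
proof (rule cInf_eq_minimum)
  have "(norm (y - mat 1 *v (\<chi> i. max 0 (y $ i))))\<^sup>2 = (\<Sum>i\<in>UNIV. (min 0 (y $ i))\<^sup>2)"
    unfolding norm_sq_vec by (intro sum.cong) (auto simp: min_def max_def)
  moreover have "nonneg_vec (\<chi> i. max 0 (y $ i))" by (simp add: nonneg_vec_def)
  ultimately show "(\<Sum>i\<in>UNIV. (min 0 (y $ i))\<^sup>2) \<in> {(norm (y - mat 1 *v x))\<^sup>2 | x. nonneg_vec x}"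
    by (smt (verit) mem_Collect_eq)
next
  fix d assume "d \<in> {(norm (y - mat 1 *v x))\<^sup>2 | x. nonneg_vec x}"
  then obtain x where x: "nonneg_vec x" "d = (norm (y - x))\<^sup>2" by auto
  have "(min 0 (y $ i))\<^sup>2 \<le> ((y - x) $ i)\<^sup>2" for i
    using x(1) by (subst abs_le_square_iff[symmetric]) (auto simp: nonneg_vec_def min_def abs_if not_le dest: spec[of _ i])
  then show "(\<Sum>i\<in>UNIV. (min 0 (y $ i))\<^sup>2) \<le> d"
    unfolding x(2) norm_sq_vec by (intro sum_mono)
qed

text \<open>The feasible set is compact and convex, so its image under the functional is exactly the
  interval; an empty feasible set gives the empty interval because its infimum is \<open>\<infinity>\<close>.\<close>
lemma mem_I_RB_mat_1:
  fixes y :: "real ^ 'n"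
  shows "c \<in> I_RB (mat 1) h \<alpha> y \<longleftrightarrow> (\<exists>x\<in>rb_feasible (mat 1) \<alpha> y. h \<bullet> x = c)"
proof
  assume c: "c \<in> I_RB (mat 1) h \<alpha> y"
  define F where "F = rb_feasible (mat 1) \<alpha> y"
  have lo: "(INF x\<in>F. ereal (h \<bullet> x)) \<le> ereal c" and hi: "ereal c \<le> (SUP x\<in>F. ereal (h \<bullet> x))"
    using c by (auto simp: I_RB_def F_def)
  \<comment> \<open>This holds for negative \<open>b\<close> as well: \<open>sqrt\<close> is odd, so
    \<open>sqrt b\<close> is then negative and both sides are false.\<close>
  have "norm v \<le> sqrt b \<longleftrightarrow> (norm v)\<^sup>2 \<le> b" for v :: "real ^ 'n" and b
    by (metis abs_norm_cancel real_sqrt_abs real_sqrt_le_iff)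
  then have F: "F = Collect nonneg_vec \<inter> cball y (sqrt (psi_sq (mat 1) \<alpha> y))"
    by (auto simp: F_def rb_feasible_def dist_norm)
  have "compact F" unfolding F by (intro closed_Int_compact closed_nonneg_vec compact_cball)
  have "connected F" unfolding F
    by (intro convex_connected convex_Int convex_nonneg_vec convex_cball)
  have "F \<noteq> {}" using lo by (auto simp: top_ereal_def)
  have cont: "continuous_on F (\<lambda>x. h \<bullet> x)" by (intro continuous_intros)
  obtain a where a: "a \<in> F" "\<And>x. x \<in> F \<Longrightarrow> h \<bullet> a \<le> h \<bullet> x"
    using continuous_attains_inf[OF \<open>compact F\<close> \<open>F \<noteq> {}\<close> cont] by blast
  obtain b where b: "b \<in> F" "\<And>x. x \<in> F \<Longrightarrow> h \<bullet> x \<le> h \<bullet> b"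
    using continuous_attains_sup[OF \<open>compact F\<close> \<open>F \<noteq> {}\<close> cont] by blast
  have "ereal (h \<bullet> a) \<le> (INF x\<in>F. ereal (h \<bullet> x))" using a by (intro INF_greatest) simp
  with lo have "h \<bullet> a \<le> c" by (metis ereal_less_eq(3) order_trans)
  have "(SUP x\<in>F. ereal (h \<bullet> x)) \<le> ereal (h \<bullet> b)" using b by (intro SUP_least) simp
  with hi have "c \<le> h \<bullet> b" by (metis ereal_less_eq(3) order_trans)
  have "connected ((\<lambda>x. h \<bullet> x) ` F)"
    using cont \<open>connected F\<close> by (rule connected_continuous_image)
  then have "c \<in> (\<lambda>x. h \<bullet> x) ` F"
    using a(1) b(1) \<open>h \<bullet> a \<le> c\<close> \<open>c \<le> h \<bullet> b\<close> unfolding connected_iff_interval by blast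
  then show "\<exists>x\<in>rb_feasible (mat 1) \<alpha> y. h \<bullet> x = c" by (auto simp: F_def)
next
  assume "\<exists>x\<in>rb_feasible (mat 1) \<alpha> y. h \<bullet> x = c"
  then show "c \<in> I_RB (mat 1) h \<alpha> y"
    unfolding I_RB_def by (auto intro: INF_lower SUP_upper)
qed

text \<open>\<open>measure\<close> is 0 on non-measurable sets, so the coverage event has to be
  shown Borel. The closed slice attains its distance from \<open>y\<close>, so the event is an
  inequality between two continuous functions of \<open>y\<close>.\<close>

lemma sets_mem_I_RB_mat_1:
  fixes h :: "real ^ 'n"
  assumes "nonneg_vec x0"
  shows "{y. h \<bullet> x0 \<in> I_RB (mat 1) h \<alpha> y} \<in> sets borel"
proof -
  define C where "C = Collect nonneg_vec \<inter> {x. h \<bullet> x = h \<bullet> x0}"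
  have "closed C" unfolding C_def
    by (intro closed_Int closed_nonneg_vec closed_Collect_eq continuous_intros)
  have "C \<noteq> {}" using assms by (auto simp: C_def)
  have "h \<bullet> x0 \<in> I_RB (mat 1) h \<alpha> y \<longleftrightarrow>
      (infdist y C)\<^sup>2 \<le> (z_quant \<alpha>)\<^sup>2 + (\<Sum>i\<in>UNIV. (min 0 (y $ i))\<^sup>2)" for y
  proof
    assume "h \<bullet> x0 \<in> I_RB (mat 1) h \<alpha> y"
    then obtain x where x: "x \<in> C" "(norm (y - x))\<^sup>2 \<le> (z_quant \<alpha>)\<^sup>2 + (\<Sum>i\<in>UNIV. (min 0 (y $ i))\<^sup>2)"
      by (auto simp: mem_I_RB_mat_1 rb_feasible_def psi_sq_def s_sq_mat_1 C_def)
    have "(infdist y C)\<^sup>2 \<le> (norm (y - x))\<^sup>2"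
      using infdist_le[OF x(1), of y] infdist_nonneg by (intro power_mono) (simp_all add: dist_norm)
    with x(2) show "(infdist y C)\<^sup>2 \<le> (z_quant \<alpha>)\<^sup>2 + (\<Sum>i\<in>UNIV. (min 0 (y $ i))\<^sup>2)" by linarith
  next
    assume le: "(infdist y C)\<^sup>2 \<le> (z_quant \<alpha>)\<^sup>2 + (\<Sum>i\<in>UNIV. (min 0 (y $ i))\<^sup>2)"
    obtain x where "x \<in> C" "infdist y C = dist y x"
      using infdist_attains_inf[OF \<open>closed C\<close> \<open>C \<noteq> {}\<close>] .
    with le show "h \<bullet> x0 \<in> I_RB (mat 1) h \<alpha> y"
      by (auto simp: mem_I_RB_mat_1 rb_feasible_def psi_sq_def s_sq_mat_1 C_def dist_norm)
  qed
  then have "{y. h \<bullet> x0 \<in> I_RB (mat 1) h \<alpha> y} =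
      {y. (infdist y C)\<^sup>2 \<le> (z_quant \<alpha>)\<^sup>2 + (\<Sum>i\<in>UNIV. (min 0 (y $ i))\<^sup>2)}" by simp
  also have "closed \<dots>"
    by (intro closed_Collect_le continuous_intros)
  finally show ?thesis by (rule borel_closed)
qed

text \<open>On \<open>|y\<^sub>1 - y\<^sub>2| \<le> \<surd>2 z\<close> the projection of \<open>y\<close> onto the ray spanned by \<open>(1, 1)\<close> is feasible.\<close>
lemma mem_I_RB_2:
  fixes y :: "real^2"
  assumes "\<bar>y$1 - y$2\<bar> \<le> sqrt 2 * z_quant \<alpha>"
  shows "0 \<in> I_RB (mat 1) (vector [1, -1]) \<alpha> y"
proof -
  define t where "t = max 0 ((y$1 + y$2) / 2)"
  have "(y$1 - y$2)\<^sup>2 \<le> (sqrt 2 * z_quant \<alpha>)\<^sup>2"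
    using assms by (metis abs_ge_zero power2_abs power_mono)
  then have D: "(y$1 - y$2)\<^sup>2 \<le> 2 * (z_quant \<alpha>)\<^sup>2" by (simp add: power_mult_distrib)
  have "(y$1 - t)\<^sup>2 + (y$2 - t)\<^sup>2 \<le> (z_quant \<alpha>)\<^sup>2 + ((min 0 (y$1))\<^sup>2 + (min 0 (y$2))\<^sup>2)"
  proof (cases "0 \<le> y$1 + y$2")
    case True
    then have "(y$1 - t)\<^sup>2 + (y$2 - t)\<^sup>2 = (y$1 - y$2)\<^sup>2 / 2"
      by (simp add: t_def max_def power2_eq_square field_simps)
    moreover have "0 \<le> (min 0 (y$1))\<^sup>2 + (min 0 (y$2))\<^sup>2" by simp
    ultimately show ?thesis using D by linarith
  next
    case False
    then have t: "t = 0" by (simp add: t_def)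
    \<comment> \<open>Here the nearest point of the ray is 0, and squares of negative coordinates
      cancel against \<open>s_sq\<close>. Only a positive coordinate \<open>p\<close> is left; as
      \<open>p < -q\<close>, it satisfies \<open>2 * p < p - q\<close>.\<close>
    have *: "p\<^sup>2 \<le> (z_quant \<alpha>)\<^sup>2" if "0 < p" "p + q < 0" "(p - q)\<^sup>2 \<le> 2 * (z_quant \<alpha>)\<^sup>2" for p q
    proof -
      have "(2 * p)\<^sup>2 \<le> (p - q)\<^sup>2" using that(1,2) by (intro power_mono) auto
      with that(3) have "4 * p\<^sup>2 \<le> 2 * (z_quant \<alpha>)\<^sup>2" by (simp add: power_mult_distrib)
      then show ?thesis using zero_le_power2[of "z_quant \<alpha>"] by linarith
    qed
    have D': "(y$2 - y$1)\<^sup>2 \<le> 2 * (z_quant \<alpha>)\<^sup>2" using D by (simp add: power2_commute)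
    consider "y$1 \<le> 0" "y$2 \<le> 0" | "0 < y$1" "y$2 \<le> 0" | "y$1 \<le> 0" "0 < y$2"
      using False by linarith
    then show ?thesis
    proof cases
      case 2
      then show ?thesis using *[of "y$1" "y$2"] False D by (simp add: t min_def)
    next
      case 3
      then show ?thesis using *[of "y$2" "y$1"] False D' by (simp add: t min_def)
    qed (simp add: t min_def)
  qed
  then have "(vector [t, t] :: real^2) \<in> rb_feasible (mat 1) \<alpha> y"
    by (simp add: rb_feasible_def psi_sq_def s_sq_mat_1 norm_sq_vec nonneg_vec_def forall_2 sum_2 t_def)
  moreover have "(vector [1, -1] :: real^2) \<bullet> vector [t, t] = 0"
    by (simp add: inner_vec_def sum_2)
  ultimately show ?thesis by (auto simp: mem_I_RB_mat_1)
qed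

lemma coverage_mat_2_ge:
  fixes a \<alpha> :: real
  assumes "0 \<le> a" "0 < \<alpha>" "\<alpha> < 1"
  shows "coverage (mat 1 :: real^2^2) (vector [1, -1]) (vector [a, a]) \<alpha> \<ge> 1 - \<alpha>"
proof -
  let ?h = "vector [1, -1] :: real^2" and ?x = "vector [a, a] :: real^2"
  let ?f = "\<lambda>(p, q). vector [p + ?x$1, q + ?x$2] :: real^2"
  define z where "z = z_quant \<alpha>"
  have z: "0 < z" "measure std_normal {-z..z} = 1 - \<alpha>"
    using z_quant_props[OF assms(2,3)] by (simp_all add: z_def)
  have hx: "?h \<bullet> ?x = 0" by (simp add: inner_vec_def sum_2)
  have meas: "?f \<in> std_normal \<Otimes>\<^sub>M std_normal \<rightarrow>\<^sub>M borel"
    unfolding case_prod_unfold by (intro measurable_vector_2) measurable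
  interpret G: prob_space "gauss_vec ?x"
    unfolding gauss_vec_2 by (rule NN.prob_space_distr) (rule meas)
  let ?B = "{y :: real^2. \<bar>y$1 - y$2\<bar> \<le> sqrt 2 * z}"
  have "closed ?B" by (intro closed_Collect_le continuous_intros)
  then have B: "?B \<in> sets borel" by (rule borel_closed)
  have E: "{y. ?h \<bullet> ?x \<in> I_RB (mat 1) ?h \<alpha> y} \<in> sets borel"
    using assms by (intro sets_mem_I_RB_mat_1) (simp add: nonneg_vec_def forall_2)
  have "1 - \<alpha> = measure (std_normal \<Otimes>\<^sub>M std_normal) {(p, q). \<bar>p - q\<bar> \<le> sqrt 2 * z}"
    using z std_normal_pair_diff[of z] by simp
  \<comment> \<open>Both coordinates have the same mean \<open>a\<close>, which cancels in the
    difference; hence the bound is uniform in \<open>a\<close>.\<close>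
  also have "{(p, q). \<bar>p - q\<bar> \<le> sqrt 2 * z} = ?f -` ?B \<inter> space (std_normal \<Otimes>\<^sub>M std_normal)"
    by (auto simp: space_pair_measure)
  also have "measure (std_normal \<Otimes>\<^sub>M std_normal) \<dots> = measure (gauss_vec ?x) ?B"
    unfolding gauss_vec_2 by (rule measure_distr[OF meas B, symmetric])
  also have "\<dots> \<le> measure (gauss_vec ?x) {y. ?h \<bullet> ?x \<in> I_RB (mat 1) ?h \<alpha> y}"
    using E by (intro G.finite_measure_mono) (auto simp: hx z_def gauss_vec_def intro: mem_I_RB_2)
  finally show ?thesis by (simp add: coverage_def)
qed

subsection \<open>Estimates for normal probabilities\<close>

lemma Collect_NN:
  assumes "Measurable.pred (std_normal \<Otimes>\<^sub>M std_normal) P"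
  shows "Collect P \<in> sets (std_normal \<Otimes>\<^sub>M std_normal)"
  using assms by (simp add: pred_def space_pair_measure)

lemma Collect_NNN:
  assumes "Measurable.pred (std_normal \<Otimes>\<^sub>M (std_normal \<Otimes>\<^sub>M std_normal)) P"
  shows "Collect P \<in> sets (std_normal \<Otimes>\<^sub>M (std_normal \<Otimes>\<^sub>M std_normal))"
  using assms by (simp add: pred_def space_pair_measure)

lemma emeasure_NN:
  assumes "S \<in> sets (std_normal \<Otimes>\<^sub>M std_normal)"
  shows "emeasure (std_normal \<Otimes>\<^sub>M std_normal) S = (\<integral>\<^sup>+a. emeasure std_normal {b. (a, b) \<in> S} \<partial>std_normal)"
  using N.emeasure_pair_measure_alt[OF assms] by (simp add: vimage_def)

lemma emeasure_NNN:
  assumes "S \<in> sets (std_normal \<Otimes>\<^sub>M (std_normal \<Otimes>\<^sub>M std_normal))"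
  shows "emeasure (std_normal \<Otimes>\<^sub>M (std_normal \<Otimes>\<^sub>M std_normal)) S =
    (\<integral>\<^sup>+a. \<integral>\<^sup>+b. emeasure std_normal {c. (a, b, c) \<in> S} \<partial>std_normal \<partial>std_normal)"
proof -
  have "Pair a -` S \<in> sets (std_normal \<Otimes>\<^sub>M std_normal)" for a
    using assms by (rule sets_Pair1)
  then show ?thesis
    using NN.emeasure_pair_measure_alt[OF assms] by (simp add: emeasure_NN)
qed

text \<open>By the symmetry \<open>(a, b) \<mapsto> (-a, -b)\<close> the half strip has half the mass of the strip.\<close>
lemma std_normal_pair_half_strip:
  assumes "0 \<le> z"
  shows "measure (std_normal \<Otimes>\<^sub>M std_normal) {(a, b). 0 < a \<and> \<bar>a - b\<bar> \<le> sqrt 2 * z}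
    \<le> measure std_normal {-z..z} / 2"
proof -
  let ?r = "sqrt 2 * z" and ?M = "std_normal \<Otimes>\<^sub>M std_normal"
  let ?P = "{(a, b). 0 < a \<and> \<bar>a - b\<bar> \<le> ?r}" and ?Q = "{(a, b). a < 0 \<and> \<bar>a - b\<bar> \<le> ?r}"
  have P: "?P \<in> sets ?M" and Q: "?Q \<in> sets ?M" and S: "{(a, b). \<bar>a - b\<bar> \<le> ?r} \<in> sets ?M"
    unfolding case_prod_unfold by (rule Collect_NN; measurable)+
  have sec: "emeasure std_normal {b. (a, b) \<in> ?P} = emeasure std_normal {b. (- a, b) \<in> ?Q}" for a
  proof (cases "0 < a")
    case True
    then have "{b. (a, b) \<in> ?P} = {a - ?r..a + ?r}"
      and "{b. (- a, b) \<in> ?Q} = {b. - b \<in> {a - ?r..a + ?r}}" by auto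
    then show ?thesis by (simp only: emeasure_std_normal_uminus sets.top borel_closed closed_atLeastAtMost)
  qed simp
  have "(\<lambda>a. emeasure std_normal {b. (a, b) \<in> ?Q}) \<in> borel_measurable std_normal"
    using N.measurable_emeasure_Pair[OF Q] by (simp add: vimage_def)
  then have m: "(\<lambda>a. emeasure std_normal {b. (a, b) \<in> ?Q}) \<in> borel_measurable borel" by simp
  have "distr std_normal borel uminus = std_normal"
    by (rule measure_eqI) (simp_all add: emeasure_distr vimage_def emeasure_std_normal_uminus)
  then have "emeasure ?M ?Q = (\<integral>\<^sup>+a. emeasure std_normal {b. (a, b) \<in> ?Q} \<partial>distr std_normal borel uminus)"
    by (simp add: emeasure_NN[OF Q])
  also have "\<dots> = (\<integral>\<^sup>+a. emeasure std_normal {b. (- a, b) \<in> ?Q} \<partial>std_normal)"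
    by (rule nn_integral_distr) (use m in simp_all)
  also have "\<dots> = emeasure ?M ?P"
    by (simp only: emeasure_NN[OF P] sec)
  finally have "measure ?M ?Q = measure ?M ?P" by (simp add: measure_def)
  moreover have "measure ?M ?P + measure ?M ?Q = measure ?M (?P \<union> ?Q)"
    by (rule NN.finite_measure_Union[symmetric, OF P Q]) auto
  moreover have "measure ?M (?P \<union> ?Q) \<le> measure ?M {(a, b). \<bar>a - b\<bar> \<le> ?r}"
    using S by (intro NN.finite_measure_mono) auto
  ultimately show ?thesis using std_normal_pair_diff[OF assms] by simp
qed

text \<open>The derivative is bounded by 1, since
  \<open>\<bar>t\<bar> \<le> 1 + t^2/2 \<le> exp (t^2/2)\<close>. On a short interval the density
  can thus be replaced by its central value at the cost of the radius.\<close>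

lemma std_normal_density_lipschitz:
  "std_normal_density x \<le> std_normal_density a + \<bar>x - a\<bar>"
proof -
  have deriv: "(std_normal_density has_real_derivative (- t * std_normal_density t)) (at t)" for t
    unfolding std_normal_density_def
    by (auto intro!: derivative_eq_intros simp: field_simps)
  have bound: "norm (- t * std_normal_density t) \<le> 1" for t
  proof -
    have "\<bar>t\<bar> \<le> 1 + t\<^sup>2 / 2"
      using zero_le_power2[of "\<bar>t\<bar> - 1"] by (simp add: power2_eq_square algebra_simps)
    also have "\<dots> \<le> exp (t\<^sup>2 / 2)" by (rule exp_ge_add_one_self)
    finally have "\<bar>t\<bar> * exp (- t\<^sup>2 / 2) \<le> 1"
      by (simp add: exp_minus field_simps)
    moreover have "1 \<le> sqrt (2 * pi)"
      using pi_ge_two by simp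
    ultimately show ?thesis
      by (simp del: real_sqrt_ge_1_iff add: std_normal_density_def abs_mult divide_le_eq)
  qed
  have "norm (std_normal_density x - std_normal_density a) \<le> 1 * norm (x - a)"
    by (rule field_differentiable_bound[of UNIV])
       (use deriv bound in \<open>auto intro: has_field_derivative_at_within\<close>)
  then show ?thesis by simp
qed

text \<open>The first bound keeps the decay in \<open>a\<close> and serves the face with both
  coordinates positive; the second, uniform in \<open>a\<close>, suffices for the thin
  strips.\<close>

lemma std_normal_band_le:
  assumes "0 \<le> r"
  shows "emeasure std_normal {w. \<bar>w - a\<bar> \<le> r} \<le> ennreal (2 * r * (std_normal_density a + r))"
    and "emeasure std_normal {w. \<bar>w - a\<bar> \<le> r} \<le> ennreal (2 * r * std_normal_density 0)"
proof -
  have eq: "{w. \<bar>w - a\<bar> \<le> r} = {a - r..a + r}" by auto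
  have "std_normal_density x \<le> std_normal_density a + r" if "x \<in> {a - r..a + r}" for x
    using std_normal_density_lipschitz[of x a] that by auto
  from emeasure_std_normal_interval_le[OF _ this, of "a - r" "a + r"] assms
  show "emeasure std_normal {w. \<bar>w - a\<bar> \<le> r} \<le> ennreal (2 * r * (std_normal_density a + r))"
    unfolding eq by (simp add: mult.commute mult.left_commute)
  have "std_normal_density x \<le> std_normal_density 0" for x
    by (rule std_normal_density_antimono_abs) simp
  from emeasure_std_normal_interval_le[OF _ this, of "a - r" "a + r"] assms
  show "emeasure std_normal {w. \<bar>w - a\<bar> \<le> r} \<le> ennreal (2 * r * std_normal_density 0)"
    unfolding eq by (simp add: mult.commute mult.left_commute)
qed

text \<open>Rational bounds for the final numerical comparison. They come from
  \<open>2 \<le> pi < 4\<close>: the square of 20/7 exceeds 8, and the square of 2 is 4.\<close>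

lemma std_normal_density_0: "std_normal_density 0 \<in> {7/20..1/2}"
proof -
  have "sqrt (2 * pi) \<le> sqrt ((20/7)\<^sup>2)"
    using pi_less_4 by (intro real_sqrt_le_mono) (simp add: power2_eq_square)
  then have u: "sqrt (2 * pi) \<le> 20/7" by simp
  have "sqrt (2\<^sup>2) \<le> sqrt (2 * pi)"
    using pi_ge_two by (intro real_sqrt_le_mono) simp
  then have l: "2 \<le> sqrt (2 * pi)" by simp
  have "std_normal_density 0 = 1 / sqrt (2 * pi)" by (simp add: std_normal_density_def)
  moreover have "7/20 \<le> 1 / sqrt (2 * pi)" "1 / sqrt (2 * pi) \<le> 1/2"
    using u l by (simp_all only: le_divide_eq divide_le_eq) auto
  ultimately show ?thesis by simp
qed

text \<open>The squared density is \<open>std_normal_density 0\<close> times the density at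
  \<open>sqrt 2 * u\<close>, so a substitution reduces the integral to the half-line mass
  1/2.\<close>

lemma std_normal_positive_half_density:
  "(\<integral>\<^sup>+u. indicator {0<..} u * ennreal (std_normal_density u) \<partial>std_normal) =
    ennreal (std_normal_density 0 / (2 * sqrt 2))"
proof -
  let ?p0 = "std_normal_density 0"
  have sq: "std_normal_density u * std_normal_density u = ?p0 * std_normal_density (sqrt 2 * u)" for u
    by (simp add: std_normal_density_def power_mult_distrib exp_add[symmetric])
  have "emeasure std_normal {0<..} = ennreal (1/2)"
    by (simp only: N.emeasure_eq_measure std_normal_half)
  then have "ennreal (1/2) = (\<integral>\<^sup>+x. ennreal (std_normal_density x) * indicator {0<..} x \<partial>lborel)"
    by (simp add: emeasure_density)
  also have "\<dots> = ennreal (sqrt 2) *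
      (\<integral>\<^sup>+u. ennreal (std_normal_density (sqrt 2 * u)) * indicator {0<..} (sqrt 2 * u) \<partial>lborel)"
    by (subst nn_integral_real_affine[of _ "sqrt 2" 0]) auto
  also have "\<dots> = ennreal (sqrt 2) *
      (\<integral>\<^sup>+u. ennreal (std_normal_density (sqrt 2 * u)) * indicator {0<..} u \<partial>lborel)"
    by (intro arg_cong2[where f="(*)"] nn_integral_cong refl) (simp add: indicator_def zero_less_mult_iff)
  finally have half: "ennreal (1/2) = ennreal (sqrt 2) *
      (\<integral>\<^sup>+u. ennreal (std_normal_density (sqrt 2 * u)) * indicator {0<..} u \<partial>lborel)" (is "_ = _ * ?I") .
  have "(\<integral>\<^sup>+u. indicator {0<..} u * ennreal (std_normal_density u) \<partial>std_normal) =
      (\<integral>\<^sup>+u. ennreal ?p0 * (ennreal (std_normal_density (sqrt 2 * u)) * indicator {0<..} u) \<partial>lborel)"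
    by (subst nn_integral_density)
       (auto intro!: nn_integral_cong simp: indicator_def ennreal_mult[symmetric] sq)
  also have "\<dots> = ennreal ?p0 * ?I" by (rule nn_integral_cmult) simp
  also have "\<dots> = ennreal (?p0 / sqrt 2) * (ennreal (sqrt 2) * ?I)"
    by (simp add: mult.assoc[symmetric] ennreal_mult[symmetric])
  also have "\<dots> = ennreal (?p0 / sqrt 2) * ennreal (1/2)" by (simp only: half)
  also have "\<dots> = ennreal (?p0 / (2 * sqrt 2))" by (subst ennreal_mult[symmetric]) (simp_all add: mult.commute)
  finally show ?thesis .
qed

subsection \<open>Small intervals in dimension three\<close>

lemma square_le_imp_abs_le:
  fixes x z c :: real
  assumes "x\<^sup>2 \<le> c * z\<^sup>2" "0 \<le> z"
  shows "\<bar>x\<bar> \<le> sqrt c * z"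
proof -
  have "sqrt (x\<^sup>2) \<le> sqrt (c * z\<^sup>2)" using assms(1) by (rule real_sqrt_le_mono)
  then show ?thesis using assms(2) by (simp add: real_sqrt_mult)
qed

text \<open>The hypothesis is feasibility of \<open>x = (s, t, 1 + s + t)\<close> for the data \<open>y = (u, v, 1 + w)\<close>.\<close>
lemma feasible_bands:
  fixes s t u v w z :: real
  assumes st: "0 \<le> s" "0 \<le> t" and z: "0 < z" "z < 1"
    and le: "(u - s)\<^sup>2 + (v - t)\<^sup>2 + (w - s - t)\<^sup>2 \<le>
      z\<^sup>2 + ((min 0 u)\<^sup>2 + (min 0 v)\<^sup>2 + (min 0 (1 + w))\<^sup>2)"
  defines "near \<equiv> \<bar>w - (max 0 u + max 0 v)\<bar> \<le> sqrt 3 * z"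
  shows "(u \<le> 0 \<and> v \<le> 0 \<and> \<bar>w\<bar> \<le> z) \<or> (0 < u \<and> v \<le> 0 \<and> \<bar>u - w\<bar> \<le> sqrt 2 * z) \<or>
    (u \<le> 0 \<and> 0 < v \<and> \<bar>v - w\<bar> \<le> sqrt 2 * z) \<or> (0 < u \<and> 0 < v \<and> near) \<or>
    (\<bar>u\<bar> \<le> 2 * z \<and> near) \<or> (\<bar>v\<bar> \<le> 2 * z \<and> near)"
proof -
  \<comment> \<open>The contribution of \<open>p\<close> to \<open>s_sq\<close> is subtracted,
    leaving the distance from the positive part of \<open>p\<close> plus a cross term. That term
    penalises a positive \<open>q\<close> when \<open>p\<close> is negative, and the sectors with a
    negative coordinate rely on it.\<close>
  have clip: "(max 0 p - q)\<^sup>2 + 2 * max 0 (- p) * q \<le> (p - q)\<^sup>2 - (min 0 p)\<^sup>2" if "0 \<le> q" for p q :: real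
    using that by (cases "0 \<le> p") (simp_all add: power2_eq_square algebra_simps)
  define U V where "U = max 0 u" and "V = max 0 v"
  have U': "0 \<le> max 0 (- u) * s" and V': "0 \<le> max 0 (- v) * t" using st by simp_all
  have main: "(U - s)\<^sup>2 + 2 * max 0 (- u) * s + (V - t)\<^sup>2 + 2 * max 0 (- v) * t + (w - s - t)\<^sup>2
      \<le> z\<^sup>2 + (min 0 (1 + w))\<^sup>2"
    using clip[OF st(1), of u] clip[OF st(2), of v] le unfolding U_def V_def by linarith
  have "z\<^sup>2 < 1" using z by (simp add: abs_square_less_1)
  \<comment> \<open>If \<open>w < -1\<close>, the third residual alone costs at least
    \<open>w^2\<close>, while the allowance \<open>z^2 + (1 + w)^2\<close> is smaller than
    \<open>w^2\<close> because \<open>z < 1\<close>.\<close>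
  have "0 \<le> 1 + w"
  proof (rule ccontr)
    assume neg: "\<not> 0 \<le> 1 + w"
    then have "w\<^sup>2 \<le> (w - s - t)\<^sup>2"
      using st by (subst abs_le_square_iff[symmetric]) auto
    moreover have "(min 0 (1 + w))\<^sup>2 = 1 + 2 * w + w\<^sup>2"
      using neg by (simp add: power2_eq_square algebra_simps)
    ultimately show False
      using main \<open>z\<^sup>2 < 1\<close> neg U' V' zero_le_power2[of "U - s"] zero_le_power2[of "V - t"] by linarith
  qed
  then have main: "(U - s)\<^sup>2 + 2 * max 0 (- u) * s + (V - t)\<^sup>2 + 2 * max 0 (- v) * t + (w - s - t)\<^sup>2 \<le> z\<^sup>2"
    using main by simp
  \<comment> \<open>Cauchy-Schwarz for three residuals: \<open>w - (U + V)\<close> is the sum of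
    \<open>w - s - t\<close>, \<open>s - U\<close> and \<open>t - V\<close>. The factor
    \<open>sqrt 3\<close> is the length of the normal \<open>(1, 1, -1)\<close>.\<close>
  have cs3: "(p + q + d)\<^sup>2 \<le> 3 * (p\<^sup>2 + q\<^sup>2 + d\<^sup>2)" for p q d :: real
    using zero_le_power2[of "p - q"] zero_le_power2[of "q - d"] zero_le_power2[of "p - d"]
    by (simp add: power2_eq_square algebra_simps)
  have "(w - (U + V))\<^sup>2 \<le> 3 * z\<^sup>2"
    using cs3[of "w - s - t" "s - U" "t - V"] main U' V'
    by (simp add: power2_commute[of s U] power2_commute[of t V] algebra_simps)
  then have near: near
    unfolding near_def U_def V_def using z by (intro square_le_imp_abs_le) auto
  have "sqrt 3 \<le> 2" by (rule real_le_lsqrt) auto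
  then have "sqrt 3 * z \<le> 2 * z" using z by simp
  with near have near2: "\<bar>w - (U + V)\<bar> \<le> 2 * z"
    unfolding near_def U_def V_def by linarith
  have cs2: "(p + q)\<^sup>2 \<le> 2 * (p\<^sup>2 + q\<^sup>2)" for p q :: real
    using zero_le_power2[of "p - q"] by (simp add: power2_eq_square algebra_simps)
  have lin: "d + 4 * e \<le> 2 * y" if "d \<le> 2 * (a + c)" "a + b + 2 * e + c \<le> y" "0 \<le> b"
    for a b c d e y :: real
    using that by simp
  \<comment> \<open>Two residuals give the factor \<open>sqrt 2\<close>, once the displacement
    \<open>b\<close> is eliminated. Its cross term with \<open>w - p\<close> is absorbed by the
    penalty, because \<open>w - p \<le> 2 * z < -q\<close>.\<close>
  have mixed: "\<bar>p - w\<bar> \<le> sqrt 2 * z"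
    if p: "0 < p" and q: "q < - (2 * z)" and ab: "0 \<le> a" "0 \<le> b" and w: "\<bar>w - p\<bar> \<le> 2 * z"
      and m: "(p - a)\<^sup>2 + b\<^sup>2 + 2 * (- q) * b + (w - a - b)\<^sup>2 \<le> z\<^sup>2" for p q a b
  proof (rule square_le_imp_abs_le)
    have "(w - p - b)\<^sup>2 \<le> 2 * ((p - a)\<^sup>2 + (w - a - b)\<^sup>2)"
      using cs2[of "a - p" "w - a - b"] by (simp add: power2_commute[of a p] algebra_simps)
    then have "(w - p - b)\<^sup>2 + 4 * ((- q) * b) \<le> 2 * z\<^sup>2"
      by (rule lin[OF _ m[unfolded mult.assoc] zero_le_power2])
    moreover have "(w - p - b)\<^sup>2 = (p - w)\<^sup>2 - 2 * (w - p) * b + b\<^sup>2"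
      by (simp add: power2_eq_square algebra_simps)
    moreover have "(w - p) * b \<le> (- q) * b" using w q ab by (intro mult_right_mono) auto
    moreover have "0 \<le> (- q) * b" using q z ab by (intro mult_nonneg_nonneg) auto
    ultimately show "(p - w)\<^sup>2 \<le> 2 * z\<^sup>2" using zero_le_power2[of b] by linarith
  qed (use z in simp)
  \<comment> \<open>The threshold \<open>2 * z\<close> dominates the bound on
    \<open>w - (U + V)\<close>, so beyond it the penalties absorb all cross terms. Inside the strips
    only \<open>near\<close> is kept, which costs a second-order probability.\<close>
  consider "\<bar>u\<bar> \<le> 2 * z \<or> \<bar>v\<bar> \<le> 2 * z" | "0 < u" "0 < v" | "0 < u" "v < - (2 * z)"
    | "u < - (2 * z)" "0 < v" | "u < - (2 * z)" "v < - (2 * z)"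
    using z by (smt (verit))
  then show ?thesis
  proof cases
    case 1
    with near show ?thesis by blast
  next
    case 2
    with near show ?thesis by blast
  next
    case 3
    have "\<bar>w - u\<bar> \<le> 2 * z" using near2 3 z by (simp add: U_def V_def)
    from mixed[OF 3 st this] main 3 z show ?thesis by (simp add: U_def V_def)
  next
    case 4
    have "\<bar>w - v\<bar> \<le> 2 * z" using near2 4 z by (simp add: U_def V_def)
    from mixed[OF 4(2,1) st(2,1) this] main 4 z show ?thesis
      by (simp add: U_def V_def algebra_simps)
  next
    case 5
    have "\<bar>w\<bar> \<le> 2 * z" using near2 5 z by (simp add: U_def V_def)
    \<comment> \<open>With both coordinates strongly negative, the two penalties absorb the cross
      terms in the expansion of \<open>(w - s - t)^2\<close>.\<close>
    then have "w * s \<le> (- u) * s" "w * t \<le> (- v) * t" 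
      using 5 st by - (rule mult_right_mono; simp)+
    moreover have "s\<^sup>2 + 2 * (- u) * s + t\<^sup>2 + 2 * (- v) * t + (w - s - t)\<^sup>2 \<le> z\<^sup>2"
      using main 5 z by (simp add: U_def V_def)
    moreover have "(w - s - t)\<^sup>2 = w\<^sup>2 - 2 * (w * s) - 2 * (w * t) + (s + t)\<^sup>2"
      by (simp add: power2_eq_square algebra_simps)
    ultimately have "w\<^sup>2 \<le> z\<^sup>2"
      using zero_le_power2[of s] zero_le_power2[of t] zero_le_power2[of "s + t"] by linarith
    then have "\<bar>w\<bar> \<le> z" using z by (simp add: abs_le_square_iff[symmetric])
    with 5 z show ?thesis by simp
  qed
qed

text \<open>For positive \<open>u\<close> and \<open>v\<close>, dropping \<open>2 * u * v\<close>
  from \<open>(u + v)^2\<close> bounds the density at \<open>u + v\<close> by a product. The double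
  integral then factorises into two copies of the half-line integral, and their product yields the
  1/8.\<close>

lemma std_normal_both_positive_band:
  assumes "0 \<le> r"
  shows "measure (std_normal \<Otimes>\<^sub>M (std_normal \<Otimes>\<^sub>M std_normal))
      {(u, v, w). 0 < u \<and> 0 < v \<and> \<bar>w - (max 0 u + max 0 v)\<bar> \<le> r}
    \<le> 2 * r * (std_normal_density 0 / 8 + r)"
proof -
  let ?T = "{(u::real, v::real, w::real). 0 < u \<and> 0 < v \<and> \<bar>w - (max 0 u + max 0 v)\<bar> \<le> r}"
  let ?M = "std_normal \<Otimes>\<^sub>M (std_normal \<Otimes>\<^sub>M std_normal)"
  let ?g = "\<lambda>u. indicator {0<..} u * ennreal (std_normal_density u)"
  let ?p0 = "std_normal_density 0"
  have p0: "0 < ?p0" using std_normal_density_0 by simp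
  have T: "?T \<in> sets ?M"
    unfolding case_prod_unfold by (rule Collect_NNN; measurable)
  have ennreal_eq: "ennreal (a * (b * c) + d) = ennreal a * (ennreal b * ennreal c) + ennreal d"
    if "0 \<le> a" "0 \<le> b" "0 \<le> c" "0 \<le> d" for a b c d
    using that by (simp add: ennreal_mult)
  have bd: "emeasure std_normal {w. (u, v, w) \<in> ?T} \<le>
      ennreal (2 * r / ?p0) * (?g u * ?g v) + ennreal (2 * r * r)" for u v
  proof (cases "0 < u \<and> 0 < v")
    case True
    have "std_normal_density (u + v) * ?p0 \<le> std_normal_density u * std_normal_density v"
    proof -
      have "exp (- (u + v)\<^sup>2 / 2) \<le> exp (- u\<^sup>2 / 2) * exp (- v\<^sup>2 / 2)"
        using True by (simp add: exp_add[symmetric] power2_eq_square field_simps)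
      then show ?thesis by (simp add: std_normal_density_def divide_right_mono)
    qed
    then have d: "std_normal_density (u + v) \<le> std_normal_density u * std_normal_density v / ?p0"
      using p0 by (simp add: pos_le_divide_eq)
    have "{w. (u, v, w) \<in> ?T} = {w. \<bar>w - (u + v)\<bar> \<le> r}" using True by auto
    then have "emeasure std_normal {w. (u, v, w) \<in> ?T} \<le> ennreal (2 * r * (std_normal_density (u + v) + r))"
      using std_normal_band_le(1)[OF assms] by simp
    also have "\<dots> \<le> ennreal (2 * r / ?p0 * (std_normal_density u * std_normal_density v) + 2 * r * r)"
      using mult_left_mono[OF d, of "2 * r"] assms by (intro ennreal_leI) (simp add: algebra_simps)
    also have "\<dots> = ennreal (2 * r / ?p0) * (?g u * ?g v) + ennreal (2 * r * r)"
      using True assms p0 by (subst ennreal_eq) simp_all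
    finally show ?thesis .
  qed auto
  have "emeasure ?M ?T \<le> (\<integral>\<^sup>+u. \<integral>\<^sup>+v. ennreal (2 * r / ?p0) * (?g u * ?g v) + ennreal (2 * r * r) \<partial>std_normal \<partial>std_normal)"
    unfolding emeasure_NNN[OF T] by (intro nn_integral_mono bd)
  also have "\<dots> = ennreal (2 * r / ?p0) * ((\<integral>\<^sup>+u. ?g u \<partial>std_normal) * (\<integral>\<^sup>+v. ?g v \<partial>std_normal)) + ennreal (2 * r * r)"
    using N.emeasure_space_1
    by (simp add: nn_integral_add nn_integral_cmult nn_integral_multc del: space_density)
  also have "\<dots> = ennreal (2 * r / ?p0 * (?p0 / (2 * sqrt 2) * (?p0 / (2 * sqrt 2))) + 2 * r * r)"
    unfolding std_normal_positive_half_density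
    using assms p0 by (subst ennreal_eq) simp_all
  also have "2 * r / ?p0 * (?p0 / (2 * sqrt 2) * (?p0 / (2 * sqrt 2))) + 2 * r * r = 2 * r * (?p0 / 8 + r)"
    using p0 by (simp add: field_simps)
  finally show ?thesis
    using assms p0 by (simp add: NNN.emeasure_eq_measure)
qed

text \<open>The constraints on one horizontal coordinate and on \<open>w\<close> each cost a factor
  linear in the width. With \<open>r\<close> and \<open>d\<close> proportional to \<open>z\<close>
  these pieces are of order \<open>z^2\<close>.\<close>

lemma std_normal_strip_band:
  assumes "0 \<le> r" "0 \<le> d"
  shows "measure (std_normal \<Otimes>\<^sub>M (std_normal \<Otimes>\<^sub>M std_normal))
      {(u, v, w). \<bar>u\<bar> \<le> d \<and> \<bar>w - (max 0 u + max 0 v)\<bar> \<le> r} \<le> 4 * r * d * (std_normal_density 0)\<^sup>2"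
    (is "measure ?M ?S \<le> _")
    and "measure (std_normal \<Otimes>\<^sub>M (std_normal \<Otimes>\<^sub>M std_normal))
      {(u, v, w). \<bar>v\<bar> \<le> d \<and> \<bar>w - (max 0 u + max 0 v)\<bar> \<le> r} \<le> 4 * r * d * (std_normal_density 0)\<^sup>2"
    (is "measure _ ?S' \<le> _")
proof -
  let ?p0 = "std_normal_density 0"
  have p0: "0 < ?p0" using std_normal_density_0 by simp
  let ?D = "{u. \<bar>u\<bar> \<le> d}"
  have D: "?D \<in> sets borel" by (intro borel_closed closed_Collect_le continuous_intros)
  have S: "?S \<in> sets ?M" "?S' \<in> sets ?M"
    unfolding case_prod_unfold by (rule Collect_NNN; measurable)+
  have Dm: "emeasure std_normal ?D \<le> ennreal (2 * d * ?p0)"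
    using std_normal_band_le(2)[OF assms(2), of 0] by simp
  have one: "emeasure std_normal UNIV = 1" using N.emeasure_space_1 by simp
  have fin: "ennreal (2 * r * ?p0) * emeasure std_normal ?D \<le> ennreal (4 * r * d * ?p0\<^sup>2)"
  proof -
    have "ennreal (2 * r * ?p0) * emeasure std_normal ?D \<le> ennreal (2 * r * ?p0) * ennreal (2 * d * ?p0)"
      by (intro mult_left_mono Dm) simp
    also have "\<dots> = ennreal (4 * r * d * ?p0\<^sup>2)"
      using assms p0 by (simp add: ennreal_mult[symmetric] power2_eq_square algebra_simps)
    finally show ?thesis .
  qed
  have "emeasure ?M ?S \<le> (\<integral>\<^sup>+u. \<integral>\<^sup>+v. ennreal (2 * r * ?p0) * indicator ?D u \<partial>std_normal \<partial>std_normal)"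
    unfolding emeasure_NNN[OF S(1)]
    using std_normal_band_le(2)[OF assms(1)] by (intro nn_integral_mono) (auto simp: indicator_def)
  also have "\<dots> = ennreal (2 * r * ?p0) * emeasure std_normal ?D"
    using D by (simp add: one nn_integral_cmult)
  also note fin
  finally show "measure ?M ?S \<le> 4 * r * d * ?p0\<^sup>2"
    using assms by (simp add: NNN.emeasure_eq_measure)
  have "emeasure ?M ?S' \<le> (\<integral>\<^sup>+u. \<integral>\<^sup>+v. ennreal (2 * r * ?p0) * indicator ?D v \<partial>std_normal \<partial>std_normal)"
    unfolding emeasure_NNN[OF S(2)]
    using std_normal_band_le(2)[OF assms(1)] by (intro nn_integral_mono) (auto simp: indicator_def)
  also have "\<dots> = ennreal (2 * r * ?p0) * emeasure std_normal ?D"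
    using D by (simp add: one nn_integral_cmult)
  also note fin
  finally show "measure ?M ?S' \<le> 4 * r * d * ?p0\<^sup>2"
    using assms by (simp add: NNN.emeasure_eq_measure)
qed

text \<open>These are the three right-angled faces. The first and third sets are products in the
  given nesting; in the second the free coordinate \<open>v\<close> sits between \<open>u\<close>
  and \<open>w\<close>, so it is integrated out by Fubini.\<close>

lemma std_normal_sign_pieces:
  assumes "0 \<le> z"
  shows "measure (std_normal \<Otimes>\<^sub>M (std_normal \<Otimes>\<^sub>M std_normal))
      {(u, v, w). u \<le> 0 \<and> v \<le> 0 \<and> \<bar>w\<bar> \<le> z} \<le> measure std_normal {-z..z} / 4"
      (is "measure ?M ?T1 \<le> ?p / 4")
    and "measure (std_normal \<Otimes>\<^sub>M (std_normal \<Otimes>\<^sub>M std_normal))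
      {(u, v, w). 0 < u \<and> v \<le> 0 \<and> \<bar>u - w\<bar> \<le> sqrt 2 * z} \<le> measure std_normal {-z..z} / 4"
      (is "measure ?M ?T2 \<le> _")
    and "measure (std_normal \<Otimes>\<^sub>M (std_normal \<Otimes>\<^sub>M std_normal))
      {(u, v, w). u \<le> 0 \<and> 0 < v \<and> \<bar>v - w\<bar> \<le> sqrt 2 * z} \<le> measure std_normal {-z..z} / 4"
      (is "measure ?M ?T3 \<le> _")
proof -
  let ?H = "{(a, b). 0 < a \<and> \<bar>a - b\<bar> \<le> sqrt 2 * z}"
  have H: "?H \<in> sets (std_normal \<Otimes>\<^sub>M std_normal)"
    unfolding case_prod_unfold by (rule Collect_NN; measurable)
  have Hm: "measure (std_normal \<Otimes>\<^sub>M std_normal) ?H \<le> ?p / 2"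
    by (rule std_normal_pair_half_strip[OF assms])
  have neg: "emeasure std_normal {..0} = ennreal (1/2)"
    by (simp only: N.emeasure_eq_measure std_normal_half)
  have "?T1 = {..0} \<times> ({..0} \<times> {-z..z})" by auto
  then have "emeasure ?M ?T1 = ennreal (1/2) * (ennreal (1/2) * emeasure std_normal {-z..z})"
    by (simp only: NN.emeasure_pair_measure_Times N.emeasure_pair_measure_Times neg
        sets_density sets_lborel borel_closed closed_atMost closed_atLeastAtMost pair_measureI)
  also have "\<dots> = ennreal (1/2 * (1/2 * ?p))"
    by (simp only: N.emeasure_eq_measure ennreal_mult' zero_le_divide_1_iff zero_le_numeral)
  finally show "measure ?M ?T1 \<le> ?p / 4" by (simp add: NNN.emeasure_eq_measure)
  have "?T3 = {..0} \<times> ?H" by auto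
  then have T3: "emeasure ?M ?T3 = ennreal (1/2) * emeasure (std_normal \<Otimes>\<^sub>M std_normal) ?H"
    using H by (simp only: NN.emeasure_pair_measure_Times neg
        sets_density sets_lborel borel_closed closed_atMost)
  have fin: "ennreal (1/2) * emeasure (std_normal \<Otimes>\<^sub>M std_normal) ?H \<le> ennreal (?p / 4)"
  proof -
    have "ennreal (1/2) * emeasure (std_normal \<Otimes>\<^sub>M std_normal) ?H \<le> ennreal (1/2) * ennreal (?p / 2)"
      using Hm unfolding NN.emeasure_eq_measure by (intro mult_left_mono ennreal_leI) auto
    also have "\<dots> = ennreal (?p / 4)" by (subst ennreal_mult[symmetric]) auto
    finally show ?thesis .
  qed
  then have "emeasure ?M ?T3 \<le> ennreal (?p / 4)" unfolding T3 .
  then show "measure ?M ?T3 \<le> ?p / 4" by (simp add: NNN.emeasure_eq_measure)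
  have T2: "?T2 \<in> sets ?M"
    unfolding case_prod_unfold by (rule Collect_NNN; measurable)
  have "emeasure ?M ?T2 = (\<integral>\<^sup>+u. \<integral>\<^sup>+v. emeasure std_normal {b. (u, b) \<in> ?H} * indicator {..0} v \<partial>std_normal \<partial>std_normal)"
    unfolding emeasure_NNN[OF T2] by (intro nn_integral_cong) (auto simp: indicator_def)
  also have "\<dots> = (\<integral>\<^sup>+u. ennreal (1/2) * emeasure std_normal {b. (u, b) \<in> ?H} \<partial>std_normal)"
    by (intro nn_integral_cong, subst nn_integral_cmult_indicator) (simp_all add: neg mult.commute)
  also have "\<dots> = ennreal (1/2) * emeasure (std_normal \<Otimes>\<^sub>M std_normal) ?H"
    unfolding emeasure_NN[OF H]
    using N.measurable_emeasure_Pair[OF H] by (intro nn_integral_cmult) (simp add: vimage_def)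
  also note fin
  finally show "measure ?M ?T2 \<le> ?p / 4" by (simp add: NNN.emeasure_eq_measure)
qed

text \<open>The half-width \<open>z\<close> is chosen first and \<alpha> is defined from it, so the
  quantile is known by uniqueness and no inversion is required.\<close>

lemma coverage_mat_3_less:
  "\<exists>\<alpha>::real. 0 < \<alpha> \<and> \<alpha> < 1 \<and>
    coverage (mat 1 :: real^3^3) (vector [1, 1, -1]) (vector [0, 0, 1]) \<alpha> < 1 - \<alpha>"
proof -
  let ?h = "vector [1, 1, -1] :: real^3" and ?x = "vector [0, 0, 1] :: real^3"
  let ?M = "std_normal \<Otimes>\<^sub>M (std_normal \<Otimes>\<^sub>M std_normal)"
  let ?f = "\<lambda>(u, v, w). vector [u + ?x$1, v + ?x$2, w + ?x$3] :: real^3"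
  let ?p0 = "std_normal_density 0"
  \<comment> \<open>Divided by \<open>z\<close>, the leading terms leave a gap of at least 0.065 *
    7/20 > 0.022, while the second-order errors sum to less than 13.5 * \<open>z\<close>; 1/1000 is
    small enough.\<close>
  define z :: real where "z = 1/1000"
  define r where "r = sqrt 3 * z"
  define p where "p = measure std_normal {-z..z}"
  define \<alpha> where "\<alpha> = 1 - p"
  have z: "0 < z" "z < 1" by (simp_all add: z_def)
  have p0: "7/20 \<le> ?p0" "?p0 \<le> 1/2" using std_normal_density_0 by auto
  have tail: "measure std_normal {z<..} = \<alpha> / 2"
    using std_normal_central[of z] z by (simp add: \<alpha>_def p_def)
  have "0 < \<alpha>"
    using tail std_normal_tail_strict_antimono[of z "z + 1"] measure_nonneg[of std_normal "{z + 1<..}"] by linarith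
  moreover have "\<alpha> < 1"
    using std_normal_interval_pos[of "-z" z] z by (simp add: \<alpha>_def p_def)
  moreover have "coverage (mat 1) ?h ?x \<alpha> < 1 - \<alpha>"
  proof -
    have zq: "z_quant \<alpha> = z" using tail by (rule z_quant_eqI)
    have hx: "?h \<bullet> ?x = -1" by (simp add: inner_vec_def sum_3)
    define near where "near u v w \<longleftrightarrow> \<bar>w - (max 0 u + max 0 v)\<bar> \<le> r" for u v w :: real
    define T1 where "T1 = {(u :: real, v :: real, w). u \<le> 0 \<and> v \<le> 0 \<and> \<bar>w\<bar> \<le> z}"
    define T2 where "T2 = {(u, v :: real, w). 0 < u \<and> v \<le> 0 \<and> \<bar>u - w\<bar> \<le> sqrt 2 * z}"
    define T3 where "T3 = {(u :: real, v, w). u \<le> 0 \<and> 0 < v \<and> \<bar>v - w\<bar> \<le> sqrt 2 * z}"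
    define T4 where "T4 = {(u::real, v::real, w). 0 < u \<and> 0 < v \<and> near u v w}"
    define S1 where "S1 = {(u, v, w). \<bar>u\<bar> \<le> 2 * z \<and> near u v w}"
    define S2 where "S2 = {(u, v, w). \<bar>v\<bar> \<le> 2 * z \<and> near u v w}"
    note sets_defs = T1_def T2_def T3_def T4_def S1_def S2_def near_def
    have ev: "T1 \<in> sets ?M" "T2 \<in> sets ?M" "T3 \<in> sets ?M" "T4 \<in> sets ?M" "S1 \<in> sets ?M" "S2 \<in> sets ?M"
      unfolding sets_defs case_prod_unfold by (rule Collect_NNN; measurable)+
    let ?A = "{y. ?h \<bullet> ?x \<in> I_RB (mat 1) ?h \<alpha> y}"
    have A: "?A \<in> sets borel"
      by (intro sets_mem_I_RB_mat_1) (simp add: nonneg_vec_def forall_3)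
    have meas: "?f \<in> ?M \<rightarrow>\<^sub>M borel"
      unfolding case_prod_unfold by (intro measurable_vector_3) measurable
    have sub: "?f -` ?A \<inter> space ?M \<subseteq> T1 \<union> T2 \<union> T3 \<union> T4 \<union> S1 \<union> S2"
    proof
      fix q assume "q \<in> ?f -` ?A \<inter> space ?M"
      moreover obtain u v w where q: "q = (u, v, w)" by (cases q)
      ultimately have "-1 \<in> I_RB (mat 1) ?h \<alpha> (vector [u, v, w + 1])" by (simp add: hx)
      then obtain x where x: "x \<in> rb_feasible (mat 1) \<alpha> (vector [u, v, w + 1])" "?h \<bullet> x = -1"
        by (auto simp: mem_I_RB_mat_1)
      then have "x$3 = 1 + x$1 + x$2" by (simp add: inner_vec_def sum_3)
      with x(1) have st: "0 \<le> x$1" "0 \<le> x$2" and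
        "(u - x$1)\<^sup>2 + (v - x$2)\<^sup>2 + (w - x$1 - x$2)\<^sup>2 \<le>
          z\<^sup>2 + ((min 0 u)\<^sup>2 + (min 0 v)\<^sup>2 + (min 0 (1 + w))\<^sup>2)"
        by (simp_all add: rb_feasible_def psi_sq_def s_sq_mat_1 norm_sq_vec nonneg_vec_def forall_3
            sum_3 zq algebra_simps)
      from feasible_bands[OF st z this(3)] show "q \<in> T1 \<union> T2 \<union> T3 \<union> T4 \<union> S1 \<union> S2"
        by (auto simp: q sets_defs r_def)
    qed
    have "coverage (mat 1) ?h ?x \<alpha> = measure ?M (?f -` ?A \<inter> space ?M)"
      unfolding coverage_def matrix_vector_mul_lid gauss_vec_3 by (rule measure_distr[OF meas A])
    also have "\<dots> \<le> measure ?M (T1 \<union> T2 \<union> T3 \<union> T4 \<union> S1 \<union> S2)"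
      using sub ev by (intro NNN.finite_measure_mono) auto
    also have "\<dots> \<le> measure ?M T1 + measure ?M T2 + measure ?M T3 + measure ?M T4 + measure ?M S1 + measure ?M S2"
      by (intro order_trans[OF measure_Un_le] add_right_mono sets.Un ev order_refl)
    \<comment> \<open>Three faces give a quarter of \<open>p\<close> each, then come the last face
      and the two strips.\<close>
    also have "\<dots> \<le> 3/4 * p + 2 * r * (?p0 / 8 + r) + 2 * (4 * r * (2 * z) * ?p0\<^sup>2)"
      using std_normal_sign_pieces[of z] std_normal_both_positive_band[of r]
        std_normal_strip_band[of r "2 * z"] z
      unfolding sets_defs p_def by (simp add: r_def)
    also have "\<dots> < p"
    proof -
      have "2 * z * (?p0 - z) \<le> p"
      proof -
        have "?p0 - z \<le> std_normal_density x" if "x \<in> {-z..z}" for x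
          using std_normal_density_lipschitz[of 0 x] that by auto
        then have "ennreal ((?p0 - z) * (z - - z)) \<le> emeasure std_normal {-z..z}"
          using z p0 by (intro emeasure_std_normal_interval_ge) (auto simp: z_def)
        then show ?thesis by (simp add: N.emeasure_eq_measure p_def algebra_simps)
      qed
      \<comment> \<open>The last face and both strips together have to stay below the missing
        quarter of \<open>p\<close>, which the preceding bound puts at no less than the right-hand
        side.\<close>
      moreover have "2 * r * (?p0 / 8 + r) + 2 * (4 * r * (2 * z) * ?p0\<^sup>2) < z * (?p0 - z) / 2"
      proof -
        have s3: "sqrt 3 \<le> 174/100" by (rule real_le_lsqrt) (auto simp: power2_eq_square)
        have "?p0\<^sup>2 \<le> (1/2)\<^sup>2" using p0 by (intro power_mono) auto
        then have q: "sqrt 3 * ?p0\<^sup>2 \<le> 174/100 * (1/4)"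
          using s3 by (intro mult_mono) (auto simp: power2_eq_square)
        have q': "sqrt 3 * ?p0 \<le> 174/100 * ?p0" using s3 p0 by (intro mult_right_mono) auto
        \<comment> \<open>Here \<open>a\<close>, \<open>b\<close>, \<open>c\<close> stand for
          \<open>sqrt 3 * ?p0\<close>, \<open>sqrt 3 * ?p0^2\<close> and \<open>?p0\<close>, which
          makes the comparison linear with rational coefficients.\<close>
        have lin: "a / 4 + 6 * (1/1000) + 16 * (1/1000) * b < (c - 1/1000) / 2"
          if "b \<le> 174/100 * (1/4)" "a \<le> 174/100 * c" "7/20 \<le> c" for a b c :: real
          using that by simp
        have "2 * r * (?p0 / 8 + r) + 2 * (4 * r * (2 * z) * ?p0\<^sup>2) =
            z * ((sqrt 3 * ?p0) / 4 + 6 * z + 16 * z * (sqrt 3 * ?p0\<^sup>2))"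
          by (simp add: r_def power2_eq_square algebra_simps)
        also have "\<dots> < z * ((?p0 - z) / 2)"
        proof (rule mult_strict_left_mono)
          show "(sqrt 3 * ?p0) / 4 + 6 * z + 16 * z * (sqrt 3 * ?p0\<^sup>2) < (?p0 - z) / 2"
            unfolding z_def by (rule lin[OF q q' p0(1)])
        qed (use z in simp)
        finally show ?thesis by simp
      qed
      ultimately show ?thesis by linarith
    qed
    finally show ?thesis by (simp add: \<alpha>_def)
  qed
  ultimately show ?thesis by blast
qed

theorem theorem4p1:
  shows "(\<forall>a::real. \<forall>\<alpha>::real. 0 \<le> a \<and> 0 < \<alpha> \<and> \<alpha> < 1 \<longrightarrow>
            coverage (mat 1 :: real^2^2) (vector [1, -1]) (vector [a, a]) \<alpha> \<ge> 1 - \<alpha>)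
       \<and> (\<exists>\<alpha>::real. 0 < \<alpha> \<and> \<alpha> < 1 \<and>
            coverage (mat 1 :: real^3^3) (vector [1, 1, -1]) (vector [0, 0, 1]) \<alpha> < 1 - \<alpha>)"
  using coverage_mat_2_ge coverage_mat_3_less by blast

end
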